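(* Let $M$ be a $d\times d$ expanding integer matrix, let $\mathcal{D}$ be a complete set of coset representatives of $\mathbb{Z}^d/M\mathbb{Z}^d$, and let $\mathcal{T}=\mathcal{T}(M,\mathcal{D})$ be the associated self-affine tile with standard digit set. Let $R$ be the contact set, $\Gamma_R$ the contact graph, $S$ the neighbor set and $\Gamma_S$ the neighbor graph of $\mathcal{T}$. Consider the following algorithm with input $\Gamma_R$: put $Q_1=R$; for $q=2,3,\ldots$ let $Q_q\subset\mathbb{Z}^d$ be the set of nodes determined by $\Gamma_{Q_q}=\mathrm{Red}(\Gamma_{Q_{q-1}+R})$, where $Q_{q-1}+R$ is the Minkowski sum; stop at the first $q\ge 2$ with $\Gamma_{Q_q}=\Gamma_{Q_{q-1}}$ and output $\Gamma_{Q_q\setminus\{\mathbf{0}\}}$. Then this algorithm terminates after finitely many steps and its output is the neighbor graph, i.e., $\Gamma_{Q_q\setminus\{\mathbf{0}\}}=\Gamma_S$.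
   Context: A $d\times d$ integer matrix is expanding if all its eigenvalues have modulus greater than $1$. The self-affine tile $\mathcal{T}=\mathcal{T}(M,\mathcal{D})$ is the unique nonempty compact subset of $\mathbb{R}^d$ with $\mathcal{T}=\bigcup_{\mathbf{d}\in\mathcal{D}}M^{-1}(\mathcal{T}+\mathbf{d})$. Neighbor set: $S=\{\mathbf{m}\in\mathbb{Z}^d\setminus\{\mathbf{0}\} : \mathcal{T}\cap(\mathcal{T}+\mathbf{m})\neq\emptyset\}$ (a finite set). Graphs $\Gamma_A$: for $A\subset\mathbb{Z}^d$, $\Gamma_A$ is the directed labeled graph with set of vertices $A$ having an edge $\mathbf{m}\xrightarrow{\mathbf{d}|\mathbf{d}'}\mathbf{m}'$ with $\mathbf{m},\mathbf{m}'\in A$ and label $\mathbf{d}|\mathbf{d}'\in\mathcal{D}\times\mathcal{D}$ if and only if $\mathbf{m}'=M\mathbf{m}+\mathbf{d}'-\mathbf{d}$. The neighbor graph is $\Gamma_S$. For a directed graph $G$, $\mathrm{Red}(G)$ is the largest subgraph of $G$ that has no node without an outgoing edge. Contact set: let $\{\mathbf{e}_1,\ldots,\mathbf{e}_d\}$ be a basis of the lattice $\mathbb{Z}^d$, put $R_0=\{\mathbf{0},\pm\mathbf{e}_1,\ldots,\pm\mathbf{e}_d\}$ and, for $k\ge1$, $R_k=\{\mathbf{y}\in\mathbb{Z}^d : (M\mathbf{y}+\mathcal{D})\cap(\mathbf{y}'+\mathcal{D})\ne\emptyset \text{ for some } \mathbf{y}'\in R_{k-1}\}\cup R_{k-1}$.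 It is known that this nested sequence of finite sets stabilizes. Let $R'=\bigcup_{k\ge1}R_k$; the contact set $R\subset R'$ is defined by $\Gamma_R=\mathrm{Red}(\Gamma_{R'})$, and $\Gamma_R$ is the contact graph. *)

theory Defs
  imports
    "HOL-Analysis.Analysis"
    "HOL-Library.Set_Algebras"
    "Graph_Theory.Digraph_Component"
begin

section \<open>Integer matrices, digits and the self-affine tile\<close>

definition vec_of_int :: "int ^ 'n \<Rightarrow> 'a::ring_1 ^ 'n" where
  "vec_of_int x = (\<chi> i. of_int (x $ i))"

definition mat_of_int :: "int ^ 'n ^ 'm \<Rightarrow> 'a::ring_1 ^ 'n ^ 'm" where
  "mat_of_int M = (\<chi> i j. of_int (M $ i $ j))"

definition eigenvalue :: "complex ^ 'n ^ 'n \<Rightarrow> complex \<Rightarrow> bool" where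
  "eigenvalue A k \<longleftrightarrow> (\<exists>v. v \<noteq> 0 \<and> A *v v = k *s v)"

definition expanding :: "int ^ 'n ^ 'n \<Rightarrow> bool" where
  "expanding M \<longleftrightarrow> (\<forall>k. eigenvalue (mat_of_int M) k \<longrightarrow> 1 < cmod k)"

definition complete_residue_system :: "int ^ 'n ^ 'n \<Rightarrow> (int ^ 'n) set \<Rightarrow> bool" where
  "complete_residue_system M D \<longleftrightarrow> (\<forall>z. \<exists>!d. d \<in> D \<and> z - d \<in> range (\<lambda>y. M *v y))"

definition self_affine_tile :: "int ^ 'n ^ 'n \<Rightarrow> (int ^ 'n) set \<Rightarrow> (real ^ 'n) set" where
  "self_affine_tile M D =
     (THE T. T \<noteq> {} \<and> compact T \<and>
        T = (\<Union>d\<in>D. (\<lambda>x. matrix_inv (mat_of_int M) *v (x + vec_of_int d)) ` T))"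

definition neighbor_set :: "int ^ 'n ^ 'n \<Rightarrow> (int ^ 'n) set \<Rightarrow> (int ^ 'n) set" where
  "neighbor_set M D =
     {m. m \<noteq> 0 \<and> self_affine_tile M D \<inter> (\<lambda>x. x + vec_of_int m) ` self_affine_tile M D \<noteq> {}}"

section \<open>The labeled graphs and their reduction\<close>

text \<open>An arc \<open>(m, (d, d'), m')\<close> carries its source, its label \<open>d | d'\<close> and its target, so that
  arcs between the same nodes with different labels are distinct.\<close>

type_synonym 'n lattice_graph =
  "(int ^ 'n, (int ^ 'n) \<times> ((int ^ 'n) \<times> (int ^ 'n)) \<times> (int ^ 'n)) pre_digraph"

definition difference_graph ::
    "int ^ 'n ^ 'n \<Rightarrow> (int ^ 'n) set \<Rightarrow> (int ^ 'n) set \<Rightarrow> 'n::finite lattice_graph" where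
  "difference_graph M D A =
     \<lparr> verts = A,
       arcs = {(m, (d, d'), m') | m d d' m'.
                 m \<in> A \<and> m' \<in> A \<and> d \<in> D \<and> d' \<in> D \<and> m' = M *v m + d' - d},
       tail = (\<lambda>(m, l, m'). m),
       head = (\<lambda>(m, l, m'). m') \<rparr>"

definition no_dead_ends :: "('a, 'b) pre_digraph \<Rightarrow> bool" where
  "no_dead_ends G \<longleftrightarrow> (\<forall>v \<in> verts G. out_arcs G v \<noteq> {})"

definition Red :: "('a, 'b) pre_digraph \<Rightarrow> ('a, 'b) pre_digraph" where
  "Red G = (THE H. subgraph H G \<and> no_dead_ends H \<and>
              (\<forall>H'. subgraph H' G \<and> no_dead_ends H' \<longrightarrow> subgraph H' H))"

definition reduced_nodes ::
    "int ^ 'n ^ 'n \<Rightarrow> (int ^ 'n) set \<Rightarrow> (int ^ 'n) set \<Rightarrow> (int ^ 'n) set" where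
  "reduced_nodes M D A = (THE B. difference_graph M D B = Red (difference_graph M D A))"

lemma Red_difference_graph:
  "difference_graph M D (reduced_nodes M D A) = Red (difference_graph M D A)"
proof -
  let ?G = "difference_graph M D"
  define B where "B = \<Union>{verts H | H. subgraph H (?G A) \<and> no_dead_ends H}"
  have wf: "wf_digraph (?G X)" for X
    by unfold_locales (auto simp: difference_graph_def)
  have BA: "B \<subseteq> A"
    by (auto simp: B_def subgraph_def difference_graph_def)
  have sub: "subgraph (?G B) (?G A)"
    using BA wf by (auto simp: subgraph_def compatible_def) (auto simp: difference_graph_def)
  have below: "subgraph H (?G B)" if H: "subgraph H (?G A)" "no_dead_ends H" for H
  proof -
    have v: "verts H \<subseteq> B" using H by (auto simp: B_def)
    have th: "tail H = tail (?G A)" "head H = head (?G A)"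
      using H by (auto simp: subgraph_def compatible_def)
    have "arcs H \<subseteq> arcs (?G B)"
    proof
      fix e assume e: "e \<in> arcs H"
      have "e \<in> arcs (?G A)" using H e by (auto simp: subgraph_def)
      moreover have "tail H e \<in> verts H" "head H e \<in> verts H"
        using H e wf_digraph.tail_in_verts[of H e] wf_digraph.head_in_verts[of H e]
        by (auto simp only: subgraph_def)
      ultimately show "e \<in> arcs (?G B)"
        using v th by (auto simp: difference_graph_def)
    qed
    then show ?thesis
      using v th H wf by (auto simp: subgraph_def compatible_def) (auto simp: difference_graph_def)
  qed
  have nd: "no_dead_ends (?G B)"
    unfolding no_dead_ends_def
  proof
    fix x assume "x \<in> verts (?G B)"
    then obtain H where H: "subgraph H (?G A)" "no_dead_ends H" "x \<in> verts H"
      by (auto simp: difference_graph_def B_def)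
    then obtain e where "e \<in> out_arcs H x" unfolding no_dead_ends_def by blast
    moreover have "subgraph H (?G B)" using below H by blast
    ultimately have "e \<in> out_arcs (?G B) x"
      by (auto simp: subgraph_def compatible_def out_arcs_def)
    then show "out_arcs (?G B) x \<noteq> {}" by auto
  qed
  have "Red (?G A) = ?G B"
    unfolding Red_def
  proof (rule the_equality)
    fix H assume "subgraph H (?G A) \<and> no_dead_ends H \<and>
              (\<forall>H'. subgraph H' (?G A) \<and> no_dead_ends H' \<longrightarrow> subgraph H' H)"
    then have "subgraph H (?G B)" "subgraph (?G B) H" using below sub nd by auto
    then show "H = ?G B"
      by (intro pre_digraph.equality) (auto simp: subgraph_def compatible_def)
  qed (use sub nd below in auto)
  moreover have "C = B" if "?G C = ?G B" for C
    using that by (auto simp: difference_graph_def)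
  ultimately show ?thesis
    unfolding reduced_nodes_def by (metis (mono_tags, lifting) theI')
qed

section \<open>The contact set\<close>

definition lattice_basis :: "('n \<Rightarrow> int ^ 'n) \<Rightarrow> bool" where
  "lattice_basis e \<longleftrightarrow> (\<forall>z. \<exists>!c :: 'n \<Rightarrow> int. z = (\<Sum>i\<in>UNIV. c i *s e i))"

primrec contact_seq ::
    "int ^ 'n ^ 'n \<Rightarrow> (int ^ 'n) set \<Rightarrow> ('n \<Rightarrow> int ^ 'n) \<Rightarrow> nat \<Rightarrow> (int ^ 'n) set" where
  "contact_seq M D e 0 = {0} \<union> range e \<union> range (\<lambda>i. - e i)"
| "contact_seq M D e (Suc k) =
     {y. \<exists>y' \<in> contact_seq M D e k.
           (\<lambda>d. M *v y + d) ` D \<inter> (\<lambda>d. y' + d) ` D \<noteq> {}} \<union> contact_seq M D e k"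

definition contact_set ::
    "int ^ 'n ^ 'n \<Rightarrow> (int ^ 'n) set \<Rightarrow> ('n \<Rightarrow> int ^ 'n) \<Rightarrow> (int ^ 'n) set" where
  "contact_set M D e = reduced_nodes M D (\<Union>k\<in>{1..}. contact_seq M D e k)"

section \<open>The algorithm\<close>

text \<open>The sequence is indexed from 1; the value at 0 is a dummy. The sum of sets is the
  Minkowski sum.\<close>

definition algorithm_nodes ::
    "int ^ 'n ^ 'n \<Rightarrow> (int ^ 'n) set \<Rightarrow> (int ^ 'n) set \<Rightarrow> nat \<Rightarrow> (int ^ 'n) set" where
  "algorithm_nodes M D R q = ((\<lambda>Q. reduced_nodes M D (Q + R)) ^^ (q - 1)) R"

definition stops_at ::
    "int ^ 'n ^ 'n \<Rightarrow> (int ^ 'n) set \<Rightarrow> (int ^ 'n) set \<Rightarrow> nat \<Rightarrow> bool" where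
  "stops_at M D R q \<longleftrightarrow> 2 \<le> q \<and>
     difference_graph M D (algorithm_nodes M D R q) =
       difference_graph M D (algorithm_nodes M D R (q - 1)) \<and>
     (\<forall>p. 2 \<le> p \<and> p < q \<longrightarrow>
        difference_graph M D (algorithm_nodes M D R p) \<noteq>
          difference_graph M D (algorithm_nodes M D R (p - 1)))"

end

theory Submission
  imports Defs "HOL-Computational_Algebra.Fundamental_Theorem_Algebra"
begin

text \<open>A node has an infinite walk inside a finite set of nodes iff it is a difference of two points
  of the tile: expand it as a sum of terms \<open>M\<^sup>-\<^sup>k (d - d')\<close>. Hence the nodes of any finite reduced
  graph lie in \<open>S \<union> {0}\<close>, so the algorithm climbs inside a finite set and stops at some \<open>Q\<close> that is
  stable under adding \<open>R\<close> and reducing. Conversely, long walks ending in a basis vector start in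
  \<open>R\<close>. A long walk ending in \<open>s + t\<close> splits into a sum of walks ending in \<open>s\<close> and \<open>t\<close>, because the
  digits represent all residues; so, by stability of \<open>Q\<close> and induction, long walks ending in any
  fixed lattice vector start in \<open>Q\<close>. An element of \<open>S\<close> starts arbitrarily long walks ending in the
  finite set \<open>S \<union> {0}\<close>, hence belongs to \<open>Q\<close>.\<close>

section \<open>Walks in the graphs\<close>

text \<open>Reduction only asks whether a node has a successor, so labels can be forgotten and walks
  become powers of a relation.\<close>

definition step :: "int ^ 'n ^ 'n \<Rightarrow> (int ^ 'n) set \<Rightarrow> int ^ 'n \<Rightarrow> int ^ 'n \<Rightarrow> bool" where
  "step M D m m' \<longleftrightarrow> (\<exists>d\<in>D. \<exists>d'\<in>D. m' = M *v m + d' - d)"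

definition live :: "int ^ 'n ^ 'n \<Rightarrow> (int ^ 'n) set \<Rightarrow> (int ^ 'n) set \<Rightarrow> bool" where
  "live M D A \<longleftrightarrow> (\<forall>m\<in>A. \<exists>m'\<in>A. step M D m m')"

lemma difference_graph_inject [simp]:
  "difference_graph M D A = difference_graph M D B \<longleftrightarrow> A = B"
  by (auto simp: difference_graph_def)

lemma wf_difference_graph: "wf_digraph (difference_graph M D A)"
  by unfold_locales (auto simp: difference_graph_def)

lemma difference_graph_mono:
  "A \<subseteq> B \<Longrightarrow> subgraph (difference_graph M D A) (difference_graph M D B)"
  using wf_difference_graph[of M D]
  by (auto simp: subgraph_def compatible_def) (auto simp: difference_graph_def)

lemma no_dead_ends_difference_graph:
  "no_dead_ends (difference_graph M D A) \<longleftrightarrow> live M D A"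
proof -
  have "out_arcs (difference_graph M D A) m \<noteq> {} \<longleftrightarrow> (\<exists>m'\<in>A. step M D m m')" if "m \<in> A" for m
    using that by (auto simp: difference_graph_def out_arcs_def step_def)
  then show ?thesis
    by (simp add: no_dead_ends_def live_def) (simp add: difference_graph_def)
qed

lemma live_verts:
  assumes "subgraph H (difference_graph M D A)" "no_dead_ends H"
  shows "live M D (verts H)"
  unfolding live_def
proof
  fix m assume "m \<in> verts H"
  then obtain a where a: "a \<in> arcs H" "tail H a = m"
    using assms(2) by (auto simp: no_dead_ends_def out_arcs_def)
  have "head H a \<in> verts H"
    using a assms(1) wf_digraph.head_in_verts by (auto simp: subgraph_def)
  moreover have "step M D m (head H a)"
  proof -
    have "a \<in> arcs (difference_graph M D A)" "tail H = tail (difference_graph M D A)"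
        "head H = head (difference_graph M D A)"
      using a assms(1) by (auto simp: subgraph_def compatible_def)
    then show ?thesis using a(2) by (auto simp: difference_graph_def step_def)
  qed
  ultimately show "\<exists>m'\<in>verts H. step M D m m'" by blast
qed

text \<open>Whether an arc belongs to a difference graph depends only on its digits and on its
  endpoints being nodes, so every arc of \<open>H\<close> survives in the graph on
  \<open>B\<close>.\<close>

lemma subgraph_difference_graph_verts:
  assumes "subgraph H (difference_graph M D A)" "verts H \<subseteq> B"
  shows "subgraph H (difference_graph M D B)"
proof -
  have "arcs H \<subseteq> arcs (difference_graph M D B)"
  proof
    fix a assume "a \<in> arcs H"
    moreover from this have "tail H a \<in> verts H" "head H a \<in> verts H"
      using assms(1) wf_digraph.tail_in_verts wf_digraph.head_in_verts
      by (auto simp: subgraph_def)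
    moreover have "a \<in> arcs (difference_graph M D A)" if "a \<in> arcs H"
      using that assms(1) by (auto simp: subgraph_def)
    moreover have "tail H = tail (difference_graph M D A)" "head H = head (difference_graph M D A)"
      using assms(1) by (auto simp: subgraph_def compatible_def)
    ultimately show "a \<in> arcs (difference_graph M D B)"
      using assms(2) by (auto simp: difference_graph_def)
  qed
  then show ?thesis
    using assms wf_difference_graph[of M D B]
    by (auto simp: subgraph_def compatible_def) (auto simp: difference_graph_def)
qed

text \<open>Live sets are closed under unions, so \<open>A\<close> has a greatest live subset. Its
  graph contains every subgraph without dead ends, including those that omit some arcs between their
  nodes, because their node sets are live.\<close>

lemma reduced_nodes_eq: "reduced_nodes M D A = \<Union>{B. B \<subseteq> A \<and> live M D B}"
proof -
  let ?G = "difference_graph M D" and ?B = "\<Union>{B. B \<subseteq> A \<and> live M D B}"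
  have sub: "subgraph (?G ?B) (?G A)"
    by (rule difference_graph_mono) auto
  have nd: "no_dead_ends (?G ?B)"
    unfolding no_dead_ends_difference_graph live_def by blast
  have below: "subgraph H (?G ?B)" if H: "subgraph H (?G A)" "no_dead_ends H" for H
  proof (rule subgraph_difference_graph_verts[OF H(1)])
    show "verts H \<subseteq> ?B"
      using live_verts[OF H] H(1) by (auto simp: subgraph_def difference_graph_def)
  qed
  have "Red (?G A) = ?G ?B"
    unfolding Red_def
  proof (rule the_equality)
    fix H assume "subgraph H (?G A) \<and> no_dead_ends H \<and>
              (\<forall>H'. subgraph H' (?G A) \<and> no_dead_ends H' \<longrightarrow> subgraph H' H)"
    then have "subgraph H (?G ?B)" "subgraph (?G ?B) H" using below sub nd by auto
    then show "H = ?G ?B"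
      by (intro pre_digraph.equality) (auto simp: subgraph_def compatible_def)
  qed (use sub nd below in auto)
  then show ?thesis
    using Red_difference_graph[of M D A] by simp
qed

lemma reduced_nodes_subset: "reduced_nodes M D A \<subseteq> A"
  by (auto simp: reduced_nodes_eq)

lemma live_reduced_nodes: "live M D (reduced_nodes M D A)"
  unfolding reduced_nodes_eq live_def by blast

lemma reduced_nodes_greatest: "B \<subseteq> A \<Longrightarrow> live M D B \<Longrightarrow> B \<subseteq> reduced_nodes M D A"
  by (auto simp: reduced_nodes_eq)

text \<open>Only the start of a walk is constrained; its inner nodes may lie outside
  \<open>A\<close>. Asking for all large lengths lets two thresholds be merged and lets the start of
  a walk be cut off.\<close>

definition absorbed ::
    "int ^ 'n ^ 'n \<Rightarrow> (int ^ 'n) set \<Rightarrow> (int ^ 'n) set \<Rightarrow> int ^ 'n \<Rightarrow> bool" where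
  "absorbed M D A t \<longleftrightarrow> (\<forall>\<^sub>F k in sequentially. \<forall>m. (step M D ^^ k) m t \<longrightarrow> m \<in> A)"

text \<open>By the pigeonhole principle a long enough walk inside a finite set runs into a cycle.\<close>

lemma absorbed_reduced_nodes:
  assumes "absorbed M D A t" "finite A"
  shows "absorbed M D (reduced_nodes M D A) t"
proof -
  obtain K where K: "\<And>k m. k \<ge> K \<Longrightarrow> (step M D ^^ k) m t \<Longrightarrow> m \<in> A"
    using assms(1) by (auto simp: absorbed_def eventually_sequentially)
  have "m \<in> reduced_nodes M D A" if k: "k \<ge> K + card A" and m: "(step M D ^^ k) m t" for k m
  proof -
    obtain f where f: "f 0 = m" "f k = t" "\<And>i. i < k \<Longrightarrow> step M D (f i) (f (Suc i))"
      using m by (auto simp: relpowp_fun_conv)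
    have tail: "(step M D ^^ (k - i)) (f i) t" if "i \<le> k" for i
      unfolding relpowp_fun_conv
      by (rule exI[of _ "\<lambda>l. f (l + i)"]) (use that f in auto)
    \<comment> \<open>At least \<open>K\<close> steps remain after each of the first
      \<open>card A + 1\<close> nodes, so all of them lie in \<open>A\<close>.\<close>
    have inA: "f i \<in> A" if "i \<le> card A" for i
      by (rule K[OF _ tail]) (use that k in auto)
    have "\<not> inj_on f {..card A}"
      using card_inj_on_le[of f "{..card A}" A] inA assms(2) by auto
    then obtain i j where ij: "i < j" "j \<le> card A" "f i = f j"
      by (auto simp: inj_on_def) (metis linorder_neqE_nat)
    \<comment> \<open>The walk up to the first return is live: the last node before
      \<open>f j\<close> steps back to \<open>f i\<close>.\<close>
    have "live M D (f ` {..<j})"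
      unfolding live_def
    proof
      fix x assume "x \<in> f ` {..<j}"
      then obtain l where l: "l < j" "x = f l" by auto
      have "f (Suc l) \<in> f ` {..<j}"
        using l(1) ij by (cases "Suc l = j") (auto simp: image_iff intro: bexI[of _ i])
      moreover have "step M D x (f (Suc l))"
        using f(3)[of l] l ij k by simp
      ultimately show "\<exists>m'\<in>f ` {..<j}. step M D x m'" by blast
    qed
    moreover have "f ` {..<j} \<subseteq> A" using inA ij by auto
    moreover have "m \<in> f ` {..<j}" using f(1) ij by auto
    ultimately show ?thesis using reduced_nodes_greatest by blast
  qed
  then show ?thesis unfolding absorbed_def eventually_sequentially by blast
qed

section \<open>Absorption and sums of nodes\<close>

lemma absorbed_mono: "absorbed M D A t \<Longrightarrow> A \<subseteq> B \<Longrightarrow> absorbed M D B t"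
  unfolding absorbed_def by (erule eventually_mono) blast

text \<open>Insert the digit \<open>c\<close> congruent to \<open>d + v'\<close> modulo the image of
  \<open>M\<close>. It is added in the step to \<open>v'\<close> and subtracted in the step to
  \<open>w'\<close>, so it cancels in the sum.\<close>

lemma step_add_split:
  assumes "complete_residue_system M D" "step M D u (v' + w')"
  shows "\<exists>v w. u = v + w \<and> step M D v v' \<and> step M D w w'"
proof -
  obtain d d' where d: "d \<in> D" "d' \<in> D" "v' + w' = M *v u + d' - d"
    using assms(2) unfolding step_def by blast
  obtain c v where c: "c \<in> D" "d + v' - c = M *v v"
    using assms(1) unfolding complete_residue_system_def by blast
  have "v' = M *v v + c - d"
    unfolding c(2)[symmetric] by simp
  then have "step M D v v'"
    unfolding step_def using d(1) c(1) by (intro bexI)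
  moreover have "w' = M *v u + d' - d - v'"
    using d(3) by (metis add_diff_cancel_left')
  then have "w' = M *v (u - v) + d' - c"
    unfolding matrix_vector_mult_diff_distrib c(2)[symmetric] by simp
  then have "step M D (u - v) w'"
    unfolding step_def using d(2) c(1) by (intro bexI)
  ultimately show ?thesis
    by (intro exI[of _ v] exI[of _ "u - v"]) simp
qed

lemma relpowp_step_add_split:
  assumes "complete_residue_system M D" "(step M D ^^ k) u (v' + w')"
  shows "\<exists>v w. u = v + w \<and> (step M D ^^ k) v v' \<and> (step M D ^^ k) w w'"
  using assms(2)
proof (induction k arbitrary: v' w')
  case (Suc k)
  \<comment> \<open>The targets are prescribed, so the last step is split first and the sources it
    yields become the targets for the rest of the walk.\<close>
  then obtain x where x: "(step M D ^^ k) u x" "step M D x (v' + w')" by auto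
  obtain a b where "x = a + b" and ab: "step M D a v'" "step M D b w'"
    using step_add_split[OF assms(1) x(2)] by blast
  with x(1) Suc.IH obtain v w
    where vw: "u = v + w" "(step M D ^^ k) v a" "(step M D ^^ k) w b" by blast
  have "(step M D ^^ Suc k) v v'" "(step M D ^^ Suc k) w w'"
    using vw(2,3) ab by (auto intro: relpowp_Suc_I simp del: relpowp.simps)
  with vw(1) show ?case by blast
qed simp

lemma absorbed_add:
  assumes "complete_residue_system M D" "absorbed M D A s" "absorbed M D B t"
  shows "absorbed M D (A + B) (s + t)"
  unfolding absorbed_def
  using eventually_conj[OF assms(2,3)[unfolded absorbed_def]]
proof (rule eventually_mono, intro allI impI)
  fix k u assume k: "(\<forall>m. (step M D ^^ k) m s \<longrightarrow> m \<in> A) \<and> (\<forall>m. (step M D ^^ k) m t \<longrightarrow> m \<in> B)"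
    and "(step M D ^^ k) u (s + t)"
  then obtain v w where "u = v + w" "(step M D ^^ k) v s" "(step M D ^^ k) w t"
    using relpowp_step_add_split[OF assms(1)] by blast
  with k show "u \<in> A + B" by auto
qed

lemma live_relpowp:
  assumes "live M D A" "m \<in> A"
  shows "\<exists>t\<in>A. (step M D ^^ k) m t"
proof (induction k)
  case (Suc k)
  then show ?case using assms(1) unfolding live_def by (auto 0 3)
qed (use assms in auto)

text \<open>Finiteness of \<open>A\<close> gives one length that works for all targets in
  \<open>A\<close>, and liveness gives every node of \<open>A\<close> a walk of exactly that length
  ending in \<open>A\<close>.\<close>

lemma live_subset_of_absorbed:
  assumes "finite A" "live M D A" "\<And>t. t \<in> A \<Longrightarrow> absorbed M D B t"
  shows "A \<subseteq> B"
proof -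
  have "\<forall>\<^sub>F k in sequentially. \<forall>t\<in>A. \<forall>m. (step M D ^^ k) m t \<longrightarrow> m \<in> B"
    using assms(1,3) by (simp add: eventually_ball_finite absorbed_def)
  from eventually_happens'[OF sequentially_bot this]
  obtain k where "\<forall>t\<in>A. \<forall>m. (step M D ^^ k) m t \<longrightarrow> m \<in> B" ..
  then show ?thesis using live_relpowp[OF assms(2)] by blast
qed

section \<open>Lattice bases and the contact set\<close>

lemma lattice_basis_induct:
  fixes e :: "'n \<Rightarrow> int ^ 'n"
  assumes "lattice_basis e" "P 0"
    and add: "\<And>t i. P t \<Longrightarrow> P (t + e i)" and diff: "\<And>t i. P t \<Longrightarrow> P (t - e i)"
  shows "P t"
proof -
  have mult: "P (s + c *s e i)" if "P s" for s c i
  proof (induction c rule: int_induct[where k = 0])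
    case (step1 c)
    then show ?case using add[of "s + c *s e i" i] by (simp add: vector_sadd_rdistrib add.assoc)
  next
    case (step2 c)
    then show ?case using diff[of "s + c *s e i" i] by (simp add: vector_sub_rdistrib algebra_simps)
  qed (use that in simp)
  have "P (\<Sum>i\<in>I. c i *s e i)" if "finite I" for I c
    using that
  proof (induction I)
    case (insert i I)
    then show ?case using mult[of "\<Sum>i\<in>I. c i *s e i" "c i" i] by (simp add: add.commute)
  qed (use assms(2) in simp)
  moreover obtain c where "t = (\<Sum>i\<in>UNIV. c i *s e i)"
    using assms(1) unfolding lattice_basis_def by blast
  ultimately show ?thesis by simp
qed

text \<open>An equation \<open>M y + d = y' + d'\<close> between digit translates is an arc from
  \<open>y\<close> to \<open>y'\<close>, so each stage adjoins the predecessors of the one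
  before.\<close>

lemma contact_seq_Suc:
  "contact_seq M D e (Suc k) = {y. \<exists>y'\<in>contact_seq M D e k. step M D y y'} \<union> contact_seq M D e k"
proof -
  have "(\<lambda>d. M *v y + d) ` D \<inter> (\<lambda>d. y' + d) ` D \<noteq> {} \<longleftrightarrow> step M D y y'" for y y'
    by (simp add: step_def set_eq_iff image_iff algebra_simps) metis
  then show ?thesis by simp
qed

lemma contact_seq_mono: "i \<le> j \<Longrightarrow> contact_seq M D e i \<subseteq> contact_seq M D e j"
  by (rule lift_Suc_mono_le[of "contact_seq M D e"]) (auto simp: contact_seq_Suc simp del: contact_seq.simps)

lemma Union_contact_seq:
  "(\<Union>k\<in>{1..}. contact_seq M D e k) = (\<Union>k. contact_seq M D e k)"
proof
  show "(\<Union>k. contact_seq M D e k) \<subseteq> (\<Union>k\<in>{1..}. contact_seq M D e k)"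
  proof (rule UN_least)
    fix k
    have "contact_seq M D e k \<subseteq> contact_seq M D e (Suc k)"
      by (rule contact_seq_mono) simp
    also have "\<dots> \<subseteq> (\<Union>k\<in>{1..}. contact_seq M D e k)"
      by (rule UN_upper) simp
    finally show "contact_seq M D e k \<subseteq> (\<Union>k\<in>{1..}. contact_seq M D e k)" .
  qed
qed (rule UN_mono, simp_all)

lemma relpowp_step_contact_seq:
  assumes "(step M D ^^ k) m t" "t \<in> contact_seq M D e 0"
  shows "m \<in> contact_seq M D e k"
  using assms(1)
proof (induction k arbitrary: m)
  case (Suc k)
  from relpowp_Suc_D2[OF Suc.prems] show ?case
    using Suc.IH by (auto simp: contact_seq_Suc simp del: contact_seq.simps(2))
qed (use assms in auto)

text \<open>A walk of any length ending in stage 0 starts in some stage, so the union of the stages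
  absorbs; being finite, it passes this on to its reduction.\<close>

lemma absorbed_contact_set:
  assumes "finite (\<Union>k. contact_seq M D e k)" "t \<in> contact_seq M D e 0"
  shows "absorbed M D (contact_set M D e) t"
  unfolding contact_set_def Union_contact_seq
proof (rule absorbed_reduced_nodes[OF _ assms(1)])
  show "absorbed M D (\<Union>k. contact_seq M D e k) t"
    unfolding absorbed_def
    by (rule always_eventually) (use relpowp_step_contact_seq[OF _ assms(2)] in blast)
qed

text \<open>A path of basis vectors from \<open>0\<close> to \<open>t\<close> is followed backwards along the graph: every
  partial sum stays in \<open>Q + R\<close>, hence after finitely many further steps in \<open>Q\<close>.\<close>

lemma absorbed_fixed_point:
  assumes "complete_residue_system M D" "lattice_basis e"
    and "finite (\<Union>k. contact_seq M D e k)" "finite Q"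
    and "contact_set M D e \<subseteq> Q" "reduced_nodes M D (Q + contact_set M D e) \<subseteq> Q"
  shows "absorbed M D Q t"
proof -
  have fin: "finite (Q + contact_set M D e)"
    using assms(3-5) by (meson finite_set_plus finite_subset)
  have plus: "absorbed M D Q (s + r)" if "absorbed M D Q s" "r \<in> contact_seq M D e 0" for s r
    using absorbed_reduced_nodes[OF absorbed_add[OF assms(1) that(1) absorbed_contact_set[OF assms(3) that(2)]] fin]
      assms(6) by (rule absorbed_mono)
  show ?thesis
  proof (rule lattice_basis_induct[OF assms(2)])
    show "absorbed M D Q 0"
      by (rule absorbed_mono[OF absorbed_contact_set[OF assms(3)] assms(5)]) simp
  next
    fix t i assume t: "absorbed M D Q t"
    show "absorbed M D Q (t + e i)" by (rule plus[OF t]) simp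
    show "absorbed M D Q (t - e i)" using plus[OF t, of "- e i"] by simp
  qed
qed

section \<open>Powers of a matrix with small eigenvalues\<close>

text \<open>Summing the recurrence bounds each partial sum by an increasing affine function of the
  previous one with slope \<open>c < 1\<close>; the fixed point \<open>x\<close> of that function
  bounds them all.\<close>

lemma summable_norm_recurrence:
  fixes a b :: "nat \<Rightarrow> 'a::real_normed_vector"
  assumes rec: "\<And>n. norm (a (Suc n)) \<le> c * norm (a n) + norm (b n)"
    and c: "0 \<le> c" "c < 1" and b: "summable (\<lambda>n. norm (b n))"
  shows "summable (\<lambda>n. norm (a n))"
proof (rule summableI_nonneg_bounded)
  define x where "x = (norm (a 0) + (\<Sum>n. norm (b n))) / (1 - c)"
  have x: "norm (a 0) + (\<Sum>n. norm (b n)) + c * x = x"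
    using c unfolding x_def by (simp add: field_simps)
  have "0 \<le> x"
    unfolding x_def using c b by (intro divide_nonneg_nonneg add_nonneg_nonneg suminf_nonneg) auto
  show "(\<Sum>i<n. norm (a i)) \<le> x" for n
  proof (induction n)
    case (Suc n)
    have "(\<Sum>i<Suc n. norm (a i)) = norm (a 0) + (\<Sum>i<n. norm (a (Suc i)))"
      by (rule sum.lessThan_Suc_shift)
    also have "(\<Sum>i<n. norm (a (Suc i))) \<le> (\<Sum>i<n. c * norm (a i) + norm (b i))"
      by (intro sum_mono rec)
    also have "\<dots> = c * (\<Sum>i<n. norm (a i)) + (\<Sum>i<n. norm (b i))"
      by (simp add: sum.distrib sum_distrib_left)
    also have "\<dots> \<le> c * x + (\<Sum>n. norm (b n))"
      using Suc c b by (intro add_mono mult_left_mono sum_le_suminf) auto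
    finally show ?case using x by simp
  qed (use \<open>0 \<le> x\<close> in simp)
qed simp

section \<open>Polynomials in a matrix applied to a vector\<close>

lemma norm_vector_scalar_mult:
  fixes v :: "'a::real_normed_field ^ 'n"
  shows "norm (c *s v) = norm c * norm v"
  by (simp add: norm_vec_def norm_mult L2_set_right_distrib)

text \<open>This is the vector \<open>p(A) v\<close>, written with iterates of \<open>A\<close> on
  \<open>v\<close> instead of powers in a matrix ring.\<close>

definition poly_action ::
    "complex poly \<Rightarrow> complex ^ 'n ^ 'n \<Rightarrow> complex ^ 'n \<Rightarrow> complex ^ 'n" where
  "poly_action p A v = (\<Sum>i\<le>degree p. coeff p i *s (((*v) A ^^ i) v))"

lemma poly_action_altdef:
  assumes "degree p \<le> n"
  shows "poly_action p A v = (\<Sum>i\<le>n. coeff p i *s (((*v) A ^^ i) v))"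
  unfolding poly_action_def
  by (rule sum.mono_neutral_left) (use assms in \<open>auto simp: coeff_eq_0\<close>)

lemma funpow_matrix_diff:
  fixes A :: "'a::comm_ring_1 ^ 'n ^ 'n"
  shows "((*v) A ^^ i) (v - w) = ((*v) A ^^ i) v - ((*v) A ^^ i) w"
  by (induction i) (simp_all add: matrix_vector_mult_diff_distrib)

lemma funpow_matrix_scale:
  fixes A :: "'a::field ^ 'n ^ 'n"
  shows "((*v) A ^^ i) (c *s v) = c *s ((*v) A ^^ i) v"
  by (induction i) (simp_all add: vector_scalar_commute)

lemma poly_action_linear_factor:
  "poly_action ([:- k, 1:] * q) A v = poly_action q A (A *v v) - k *s poly_action q A v"
proof -
  let ?P = "\<lambda>i. ((*v) A ^^ i) v"
  have "degree ([:- k, 1:] * q) \<le> Suc (degree q)"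
    using degree_mult_le[of "[:- k, 1:]" q] by simp
  then have "poly_action ([:- k, 1:] * q) A v
      = (\<Sum>i\<le>Suc (degree q). coeff ([:- k, 1:] * q) i *s ?P i)"
    by (rule poly_action_altdef)
  \<comment> \<open>The coefficients of \<open>(X - k) q\<close> are those of \<open>X q\<close>
    minus \<open>k\<close> times those of \<open>q\<close>.\<close>
  also have "\<dots> = (\<Sum>i\<le>Suc (degree q). coeff (pCons 0 q) i *s ?P i - k *s (coeff q i *s ?P i))"
    by (intro sum.cong) (auto simp: vector_sub_rdistrib vector_smult_assoc)
  also have "\<dots> = (\<Sum>i\<le>Suc (degree q). coeff (pCons 0 q) i *s ?P i)
      - k *s (\<Sum>i\<le>Suc (degree q). coeff q i *s ?P i)"
    by (simp add: sum_subtractf vec.scale_sum_right del: sum.atMost_Suc)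
  also have "(\<Sum>i\<le>Suc (degree q). coeff (pCons 0 q) i *s ?P i)
      = (\<Sum>i\<le>degree q. coeff q i *s ((*v) A ^^ i) (A *v v))"
    by (subst sum.atMost_Suc_shift) (simp add: funpow_swap1)
  also have "(\<Sum>i\<le>Suc (degree q). coeff q i *s ?P i) = poly_action q A v"
    by (rule poly_action_altdef[symmetric]) simp
  finally show ?thesis by (simp add: poly_action_def)
qed

lemma poly_action_diff: "poly_action p A (v - w) = poly_action p A v - poly_action p A w"
  by (simp add: poly_action_def funpow_matrix_diff vector_ssub_ldistrib sum_subtractf)

lemma poly_action_scale: "poly_action p A (c *s v) = c *s poly_action p A v"
  by (simp add: poly_action_def funpow_matrix_scale vec.scale_sum_right vector_smult_assoc mult.commute)

lemma poly_action_matrix: "poly_action p A (A *v v) = A *v poly_action p A v"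
  by (simp add: poly_action_def vec.sum vector_scalar_commute funpow_swap1)

text \<open>The \<open>N + 1\<close> iterates of \<open>v\<close> in dimension \<open>N\<close>
  satisfy a linear relation, whose coefficients form \<open>p\<close>.\<close>

lemma exists_annihilating_poly: "\<exists>p. p \<noteq> 0 \<and> poly_action p A v = 0"
proof -
  let ?P = "\<lambda>i. ((*v) A ^^ i) v"
  define N where "N = vec.dim (UNIV :: (complex ^ 'a) set)"
  have "\<exists>c. (\<exists>i\<le>N. c i \<noteq> 0) \<and> (\<Sum>i\<le>N. c i *s ?P i) = 0"
  proof (cases "inj_on ?P {..N}")
    case True
    then have "card (?P ` {..N}) = Suc N" by (simp add: card_image)
    then have "vec.dependent (?P ` {..N})"
      using vec.independent_card_le_dim[of "?P ` {..N}" UNIV] N_def by fastforce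
    then obtain u where u: "\<exists>w\<in>?P ` {..N}. u w \<noteq> 0" "(\<Sum>w\<in>?P ` {..N}. u w *s w) = 0"
      by (subst (asm) vec.dependent_finite) auto
    have "(\<Sum>i\<le>N. u (?P i) *s ?P i) = 0"
      using u(2) by (simp add: sum.reindex[OF True])
    with u(1) show ?thesis by (intro exI[of _ "u \<circ> ?P"]) auto
  next
    case False
    then obtain i j where ij: "i \<le> N" "j \<le> N" "i \<noteq> j" "?P i = ?P j"
      by (auto simp: inj_on_def)
    \<comment> \<open>Linear dependence speaks of sets and misses repeated vectors; a repetition
      gives the relation \<open>X^i - X^j\<close>.\<close>
    define c :: "nat \<Rightarrow> complex" where "c l = (if l = i then 1 else 0) - (if l = j then 1 else 0)" for l
    have "(\<Sum>l\<le>N. c l *s ?P l)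
        = (\<Sum>l\<le>N. if l = i then ?P l else 0) - (\<Sum>l\<le>N. if l = j then ?P l else 0)"
      unfolding sum_subtractf[symmetric] by (rule sum.cong) (auto simp: c_def)
    also have "\<dots> = 0" using ij by simp
    finally show ?thesis using ij by (intro exI[of _ c]) (auto simp: c_def)
  qed
  then obtain c i where c: "i \<le> N" "c i \<noteq> 0" "(\<Sum>i\<le>N. c i *s ?P i) = 0" by blast
  define p where "p = Poly (map c [0..<Suc N])"
  have coeff: "coeff p i = (if i \<le> N then c i else 0)" for i
    by (auto simp: p_def nth_default_def simp del: upt_Suc)
  have "degree p \<le> N" by (rule degree_le) (simp add: coeff)
  then have "poly_action p A v = 0"
    using c(3) by (simp add: poly_action_altdef coeff)
  moreover have "p \<noteq> 0" using c(1,2) coeff[of i] by auto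
  ultimately show ?thesis by blast
qed

text \<open>Split off the roots \<open>k\<close> of a polynomial annihilating \<open>v\<close> one by one: if \<open>k\<close> is an eigenvalue,
  then \<open>A\<^sup>n v\<close> solves a linear recurrence with factor \<open>k\<close> and inhomogeneity \<open>A\<^sup>n (A - k) v\<close>;
  otherwise the factor can be cancelled.\<close>

lemma summable_matrix_powers:
  fixes A :: "complex ^ 'n ^ 'n"
  assumes ev: "\<And>k. eigenvalue A k \<Longrightarrow> cmod k < 1"
  shows "summable (\<lambda>n. norm (((*v) A ^^ n) v))"
proof -
  have "summable (\<lambda>n. norm (((*v) A ^^ n) v))" if "p \<noteq> 0" "poly_action p A v = 0" for p v
    using that
  proof (induction "degree p" arbitrary: p v)
    case 0
    then obtain c where "p = [:c:]" "c \<noteq> 0" by (metis degree_eq_zeroE pCons_0_0)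
    then have "v = 0" using 0 by (simp add: poly_action_def)
    moreover have "((*v) A ^^ n) 0 = 0" for n by (induction n) simp_all
    ultimately show ?case by simp
  next
    case (Suc n)
    then have "\<not> constant (poly p)" by (simp add: constant_degree)
    then obtain k where "poly p k = 0" using fundamental_theorem_of_algebra by blast
    then obtain q where q: "p = [:- k, 1:] * q" by (auto simp: poly_eq_0_iff_dvd elim: dvdE)
    have "q \<noteq> 0" using Suc.prems(1) q by auto
    then have deg: "n = degree q"
      using Suc.hyps(2) unfolding q by (subst (asm) degree_mult_eq) auto
    have q0: "poly_action q A (A *v v) - k *s poly_action q A v = 0"
      using Suc.prems(2) unfolding q poly_action_linear_factor .
    show ?case
    proof (cases "eigenvalue A k")
      case True
      define w where "w = A *v v - k *s v"
      have "poly_action q A w = 0"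
        unfolding w_def poly_action_diff poly_action_scale by (rule q0)
      then have w: "summable (\<lambda>n. norm (((*v) A ^^ n) w))"
        using Suc.hyps(1)[OF deg \<open>q \<noteq> 0\<close>] by blast
      show ?thesis
      proof (rule summable_norm_recurrence[OF _ _ _ w])
        fix n
        have "((*v) A ^^ Suc n) v = ((*v) A ^^ n) (k *s v + w)"
          by (simp add: w_def funpow_swap1)
        also have "\<dots> = k *s ((*v) A ^^ n) v + ((*v) A ^^ n) w"
          using funpow_matrix_diff[of n A "k *s v + w" w] by (simp add: funpow_matrix_scale algebra_simps)
        finally show "norm (((*v) A ^^ Suc n) v) \<le> cmod k * norm (((*v) A ^^ n) v) + norm (((*v) A ^^ n) w)"
          by (metis norm_triangle_ineq norm_vector_scalar_mult)
      qed (use ev[OF True] in auto)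
    next
      case False
      \<comment> \<open>The vector \<open>q(A) v\<close> lies in the kernel of \<open>A - k\<close>,
        which is trivial here.\<close>
      have "A *v poly_action q A v = k *s poly_action q A v"
        using q0 by (simp add: poly_action_matrix)
      then have "poly_action q A v = 0"
        using False unfolding eigenvalue_def by blast
      then show ?thesis using Suc.hyps(1)[OF deg \<open>q \<noteq> 0\<close>] by blast
    qed
  qed
  with exists_annihilating_poly show ?thesis by blast
qed

section \<open>The inverse of an expanding matrix\<close>

lemma vec_of_int_add: "vec_of_int (x + y) = vec_of_int x + vec_of_int y"
  and vec_of_int_diff: "vec_of_int (x - y) = vec_of_int x - vec_of_int y"
  by (simp_all add: vec_of_int_def vec_eq_iff)

lemma vec_of_int_mult: "vec_of_int (M *v x) = mat_of_int M *v vec_of_int x"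
  by (simp add: vec_of_int_def mat_of_int_def matrix_vector_mult_def)

lemma finite_int_vec_bounded:
  "finite {z :: int ^ 'n. norm (vec_of_int z :: real ^ 'n) \<le> C}"
proof (rule finite_subset)
  let ?I = "{- \<lceil>C\<rceil>..\<lceil>C\<rceil>}"
  show "finite (vec_lambda ` (UNIV \<rightarrow>\<^sub>E ?I) :: (int ^ 'n) set)"
    by (intro finite_imageI finite_PiE) auto
  show "{z :: int ^ 'n. norm (vec_of_int z :: real ^ 'n) \<le> C} \<subseteq> vec_lambda ` (UNIV \<rightarrow>\<^sub>E ?I)"
  proof safe
    fix z :: "int ^ 'n" assume z: "norm (vec_of_int z :: real ^ 'n) \<le> C"
    have "z $ i \<in> ?I" for i
    proof -
      have "\<bar>real_of_int (z $ i)\<bar> \<le> norm (vec_of_int z :: real ^ 'n)"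
        using component_le_norm_cart[of "vec_of_int z :: real ^ 'n" i] by (simp add: vec_of_int_def)
      with z show ?thesis by auto linarith+
    qed
    then show "z \<in> vec_lambda ` (UNIV \<rightarrow>\<^sub>E ?I)"
      by (intro image_eqI[of _ _ "($) z"]) auto
  qed
qed

lemma injective_imp_invertible:
  fixes A :: "'a::field ^ 'n ^ 'n"
  assumes "\<And>x. A *v x = 0 \<Longrightarrow> x = 0"
  shows "invertible A"
  unfolding invertible_left_inverse matrix_left_invertible_injective
  by (metis assms eq_iff_diff_eq_0 injI matrix_vector_mult_diff_distrib)

lemma matrix_inv_vector:
  fixes A :: "'a::field ^ 'n ^ 'n"
  assumes "invertible A"
  shows "A *v (matrix_inv A *v x) = x" "matrix_inv A *v (A *v x) = x"
proof -
  have "A ** matrix_inv A = mat 1 \<and> matrix_inv A ** A = mat 1"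
    unfolding matrix_inv_def by (rule someI_ex) (use assms in \<open>simp add: invertible_def\<close>)
  then show "A *v (matrix_inv A *v x) = x" "matrix_inv A *v (A *v x) = x"
    by (simp_all add: matrix_vector_mul_assoc)
qed

text \<open>Expansion is a condition on complex eigenvalues while the tile is real; this isometric
  embedding carries decay of matrix powers back to real vectors.\<close>

definition complex_vec :: "real ^ 'n \<Rightarrow> complex ^ 'n" where
  "complex_vec x = (\<chi> i. complex_of_real (x $ i))"

lemma norm_complex_vec: "norm (complex_vec x) = norm x"
  by (simp add: complex_vec_def norm_vec_def)

lemma mat_of_int_complex_vec: "mat_of_int M *v complex_vec x = complex_vec (mat_of_int M *v x)"
  by (simp add: complex_vec_def mat_of_int_def matrix_vector_mult_def)

text \<open>A nonzero kernel vector would make 0 an eigenvalue, and a real kernel vector is also a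
  complex one.\<close>

lemma expanding_invertible:
  assumes "expanding M"
  shows "invertible (mat_of_int M :: complex ^ 'n ^ 'n)" "invertible (mat_of_int M :: real ^ 'n ^ 'n)"
proof -
  have inj: "x = 0" if "mat_of_int M *v x = 0" for x :: "complex ^ 'n"
  proof (rule ccontr)
    assume "x \<noteq> 0"
    then have "eigenvalue (mat_of_int M) 0" using that unfolding eigenvalue_def by (auto intro!: exI[of _ x])
    then show False using assms by (auto simp: expanding_def)
  qed
  then show "invertible (mat_of_int M :: complex ^ 'n ^ 'n)" by (rule injective_imp_invertible)
  show "invertible (mat_of_int M :: real ^ 'n ^ 'n)"
  proof (rule injective_imp_invertible)
    fix x :: "real ^ 'n" assume "mat_of_int M *v x = 0"
    then have "mat_of_int M *v complex_vec x = 0"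
      by (simp add: mat_of_int_complex_vec) (simp add: complex_vec_def vec_eq_iff)
    from inj[OF this] show "x = 0" by (simp add: complex_vec_def vec_eq_iff)
  qed
qed

text \<open>Eigenvalues of the inverse are inverses of eigenvalues of \<open>M\<close>, hence of
  modulus less than 1. The complex and real inverses agree on real vectors.\<close>

lemma summable_expanding_inverse_powers:
  fixes M :: "int ^ 'n ^ 'n"
  assumes "expanding M"
  shows "summable (\<lambda>n. norm (((*v) (matrix_inv (mat_of_int M :: real ^ 'n ^ 'n)) ^^ n) x))"
proof -
  let ?M = "mat_of_int M :: complex ^ 'n ^ 'n" and ?R = "mat_of_int M :: real ^ 'n ^ 'n"
  note inv = matrix_inv_vector[OF expanding_invertible(1)[OF assms]]
    matrix_inv_vector[OF expanding_invertible(2)[OF assms]]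
  have "cmod k < 1" if ev: "eigenvalue (matrix_inv ?M) k" for k
  proof -
    obtain v where v: "v \<noteq> 0" "matrix_inv ?M *v v = k *s v"
      using ev by (auto simp: eigenvalue_def)
    have v': "v = k *s (?M *v v)"
      by (metis inv(1) v(2) vector_scalar_commute)
    then have "k \<noteq> 0" using v(1) by auto
    have "?M *v v = inverse k *s v"
      by (subst (2) v') (simp add: vector_smult_assoc \<open>k \<noteq> 0\<close>)
    then have "1 < cmod (inverse k)"
      using assms v(1) unfolding expanding_def eigenvalue_def by blast
    then show ?thesis
      using \<open>k \<noteq> 0\<close> by (simp add: norm_inverse one_less_inverse_iff)
  qed
  then have "summable (\<lambda>n. norm (((*v) (matrix_inv ?M) ^^ n) (complex_vec x)))"
    by (rule summable_matrix_powers)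
  moreover have "((*v) (matrix_inv ?M) ^^ n) (complex_vec x) = complex_vec (((*v) (matrix_inv ?R) ^^ n) x)" for n
  proof (induction n)
    case (Suc n)
    have "matrix_inv ?M *v complex_vec y = complex_vec (matrix_inv ?R *v y)" for y
      by (metis inv(2,3) mat_of_int_complex_vec)
    with Suc show ?case by simp
  qed simp
  ultimately show ?thesis by (simp add: norm_complex_vec)
qed

text \<open>Expanding \<open>x\<close> in the standard basis turns summability for single vectors
  into a bound uniform in \<open>x\<close>; \<open>b n\<close> sums the norms of the images of the
  basis vectors.\<close>

lemma summable_operator_bound:
  fixes f :: "'a::euclidean_space \<Rightarrow> 'a"
  assumes "linear f" "\<And>x. summable (\<lambda>n. norm ((f ^^ n) x))"
  obtains b where "summable b" "\<And>n. 0 \<le> b n" "\<And>n x. norm ((f ^^ n) x) \<le> b n * norm x"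
proof
  let ?b = "\<lambda>n. \<Sum>i\<in>Basis. norm ((f ^^ n) i)"
  show "summable ?b" by (rule summable_sum) (rule assms(2))
  show "0 \<le> ?b n" for n by (rule sum_nonneg) simp
  show "norm ((f ^^ n) x) \<le> ?b n * norm x" for n x
  proof -
    have lin: "linear (f ^^ n)"
    proof (induction n)
      case (Suc n)
      then show ?case unfolding funpow.simps using assms(1) by (rule linear_compose)
    qed (simp add: linear_id[unfolded id_def] id_def)
    have "norm ((f ^^ n) x) = norm (\<Sum>i\<in>Basis. (x \<bullet> i) *\<^sub>R (f ^^ n) i)"
      by (subst euclidean_representation[of x, symmetric])
         (simp only: linear_sum[OF lin] linear_cmul[OF lin])
    also have "\<dots> \<le> (\<Sum>i\<in>Basis. norm ((f ^^ n) i) * norm x)"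
      by (rule sum_norm_le) (use Basis_le_norm[of _ x] in \<open>simp add: mult.commute[of _ "norm x"] mult_right_mono\<close>)
    finally show ?thesis by (simp add: sum_distrib_right)
  qed
qed

section \<open>The tile and its neighbors\<close>

lemma closure_finite_UN:
  "finite I \<Longrightarrow> closure (\<Union>i\<in>I. A i) = (\<Union>i\<in>I. closure (A i))"
  by (induction I rule: finite_induct) (simp_all add: closure_Un)

locale expanding_digits =
  fixes M :: "int ^ 'n ^ 'n" and D :: "(int ^ 'n) set"
  assumes expanding: "expanding M" and digits: "complete_residue_system M D"
begin

abbreviation (input) rvec :: "int ^ 'n \<Rightarrow> real ^ 'n" where
  "rvec \<equiv> vec_of_int"

abbreviation (input) A :: "real ^ 'n \<Rightarrow> real ^ 'n" where
  "A x \<equiv> mat_of_int M *v x"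

abbreviation (input) B :: "real ^ 'n \<Rightarrow> real ^ 'n" where
  "B \<equiv> (*v) (matrix_inv (mat_of_int M))"

lemma A_B [simp]: "A (B x) = x" and B_A [simp]: "B (A x) = x"
  using matrix_inv_vector[OF expanding_invertible(2)[OF expanding]] by auto

lemma linear_B: "linear B"
  by simp

lemma funpow_B_diff: "(B ^^ n) (x - y) = (B ^^ n) x - (B ^^ n) y"
  by (rule funpow_matrix_diff)

lemma funpow_B_add: "(B ^^ n) (x + y) = (B ^^ n) x + (B ^^ n) y"
  using funpow_B_diff[of n "x + y" y] by (simp add: algebra_simps)

lemma funpow_B_B: "(B ^^ n) (B x) = (B ^^ Suc n) x"
  by (simp add: funpow_swap1)

lemma power_bound:
  obtains b where "summable b" "\<And>n. 0 \<le> b n" "\<And>n x. norm ((B ^^ n) x) \<le> b n * norm x"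
proof (rule summable_operator_bound[OF linear_B])
  show "summable (\<lambda>n. norm ((B ^^ n) x))" for x
    by (rule summable_expanding_inverse_powers[OF expanding])
  fix b :: "nat \<Rightarrow> real"
  assume "summable b" "\<And>n. 0 \<le> b n" "\<And>n x. norm ((B ^^ n) x) \<le> b n * norm x"
  then show thesis by (rule that)
qed

text \<open>Subtract from each digit the image under \<open>M\<close> of the rounded-down vector
  \<open>q d\<close>. The remainder stays in the same residue class, so distinct digits have
  distinct remainders, and it is the image of a point of the unit cube, so the remainders are
  bounded lattice points.\<close>

lemma finite_digits: "finite D"
proof -
  define q where "q d = (\<chi> i. \<lfloor>B (rvec d) $ i\<rfloor>)" for d
  define r where "r d = d - M *v q d" for d
  have "inj_on r D"
  proof (rule inj_onI)
    fix d d' assume dd: "d \<in> D" "d' \<in> D" "r d = r d'"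
    then have "d - d' = M *v (q d - q d')"
      by (simp add: r_def matrix_vector_mult_diff_distrib algebra_simps)
    \<comment> \<open>Both \<open>d\<close> and \<open>d'\<close> are digits for the residue class
      of \<open>d\<close>, where uniqueness applies.\<close>
    moreover have "d - d = M *v 0" by simp
    ultimately show "d = d'"
      using digits dd(1,2) unfolding complete_residue_system_def by blast
  qed
  have "norm (rvec (r d)) \<le> onorm A * CARD('n)" for d
  proof -
    let ?f = "B (rvec d) - rvec (q d)"
    have "norm ?f \<le> (\<Sum>i\<in>UNIV. \<bar>?f $ i\<bar>)" by (rule norm_le_l1_cart)
    also have "\<dots> \<le> (\<Sum>i\<in>(UNIV :: 'n set). 1)"
    proof (rule sum_mono)
      have "\<bar>a - of_int \<lfloor>a\<rfloor>\<bar> \<le> 1" for a :: real by linarith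
      then show "\<bar>?f $ i\<bar> \<le> 1" for i by (simp add: q_def vec_of_int_def)
    qed
    finally have "norm ?f \<le> CARD('n)" by simp
    have "rvec (r d) = A ?f"
      by (simp add: r_def vec_of_int_diff vec_of_int_mult matrix_vector_mult_diff_distrib)
    also have "norm (A ?f) \<le> onorm A * norm ?f"
      by (rule onorm) (rule matrix_vector_mul_bounded_linear)
    also have "\<dots> \<le> onorm A * CARD('n)"
      by (rule mult_left_mono[OF \<open>norm ?f \<le> CARD('n)\<close> onorm_pos_le])
         (rule matrix_vector_mul_bounded_linear)
    finally show ?thesis .
  qed
  then have "finite (r ` D)"
    by (intro finite_subset[OF _ finite_int_vec_bounded]) blast
  then show ?thesis using \<open>inj_on r D\<close> by (rule finite_imageD)
qed

section \<open>Digit expansions as bounded orbits\<close>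

lemma digits_bound:
  obtains C where "0 \<le> C" "\<And>d. d \<in> D \<Longrightarrow> norm (rvec d) \<le> C"
proof
  show "0 \<le> (\<Sum>d\<in>D. norm (rvec d))" by (rule sum_nonneg) simp
  show "norm (rvec d) \<le> (\<Sum>d\<in>D. norm (rvec d))" if "d \<in> D" for d
    by (rule member_le_sum[OF that]) (auto intro: finite_digits)
qed

text \<open>Here \<open>X k\<close> plays the role of the expansion with digits
  \<open>\<delta> k\<close>, \<open>\<delta> (k + 1)\<close>, and so on. Boundedness singles it out
  among the solutions of the recursion, and digits can be removed or prepended without manipulating
  series.\<close>

definition orbit :: "(nat \<Rightarrow> real ^ 'n) \<Rightarrow> (nat \<Rightarrow> real ^ 'n) \<Rightarrow> bool" where
  "orbit \<delta> X \<longleftrightarrow> bounded (range X) \<and> (\<forall>k. X k = B (X (Suc k) + \<delta> k))"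

lemma orbit_bounded: "orbit \<delta> X \<Longrightarrow> bounded (range X)"
  and orbit_step: "orbit \<delta> X \<Longrightarrow> X k = B (X (Suc k) + \<delta> k)"
  unfolding orbit_def by blast+

lemma orbit_shift: "orbit \<delta> X \<Longrightarrow> orbit (\<lambda>k. \<delta> (Suc k)) (\<lambda>k. X (Suc k))"
  unfolding orbit_def
proof (elim conjE, intro conjI)
  assume "bounded (range X)"
  then show "bounded (range (\<lambda>k. X (Suc k)))"
    by (rule bounded_subset) (rule image_subsetI, rule rangeI)
qed (rule allI, erule spec)

lemma orbit_diff:
  assumes "orbit \<delta> X" "orbit \<epsilon> Y"
  shows "orbit (\<lambda>k. \<delta> k - \<epsilon> k) (\<lambda>k. X k - Y k)"
proof -
  have "X k - Y k = B (X (Suc k) - Y (Suc k) + (\<delta> k - \<epsilon> k))" for k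
    using assms unfolding orbit_def
    by (metis (no_types, lifting) add_diff_add matrix_vector_mult_diff_distrib)
  moreover have "bounded (range (\<lambda>k. X k - Y k))"
    by (intro bounded_minus_comp orbit_bounded[OF assms(1)] orbit_bounded[OF assms(2)])
  ultimately show ?thesis unfolding orbit_def by blast
qed

lemma funpow_B_tendsto_0:
  assumes "bounded (range Y)"
  shows "(\<lambda>n. (B ^^ n) (Y n)) \<longlonglongrightarrow> 0"
proof -
  obtain b where b: "summable b" "\<And>n. 0 \<le> b n" "\<And>n x. norm ((B ^^ n) x) \<le> b n * norm x"
    by (rule power_bound) blast
  obtain C where C: "\<And>n. norm (Y n) \<le> C" using assms by (auto simp: bounded_iff)
  show ?thesis
  proof (rule Lim_null_comparison)
    show "\<forall>\<^sub>F n in sequentially. norm ((B ^^ n) (Y n)) \<le> b n * C"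
      using b(2,3) C by (intro always_eventually allI) (meson mult_left_mono order_trans)
    show "(\<lambda>n. b n * C) \<longlonglongrightarrow> 0"
      using tendsto_mult_left_zero[OF summable_LIMSEQ_zero[OF b(1)]] .
  qed
qed

text \<open>The recursion telescopes, and the remainder \<open>(B ^^ n) (X n)\<close> vanishes in
  the limit since \<open>X\<close> is bounded.\<close>

lemma orbit_sums:
  assumes "orbit \<delta> X"
  shows "(\<lambda>k. (B ^^ Suc k) (\<delta> k)) sums X 0"
proof -
  have eq: "(\<Sum>k<n. (B ^^ Suc k) (\<delta> k)) = X 0 - (B ^^ n) (X n)" for n
  proof (induction n)
    case (Suc n)
    have X: "X n = B (X (Suc n) + \<delta> n)" using assms by (rule orbit_step)
    have "(B ^^ n) (X n) = (B ^^ Suc n) (X (Suc n)) + (B ^^ Suc n) (\<delta> n)"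
      by (subst X) (simp only: funpow_B_B funpow_B_add)
    with Suc show ?case by (simp del: funpow.simps)
  qed simp
  have "(\<lambda>n. X 0 - (B ^^ n) (X n)) \<longlonglongrightarrow> X 0 - 0"
    by (intro tendsto_diff tendsto_const funpow_B_tendsto_0 orbit_bounded[OF assms])
  then show ?thesis unfolding sums_def eq by simp
qed

lemma orbit_exists:
  assumes "\<And>k. \<delta> k \<in> D"
  shows "\<exists>X. orbit (\<lambda>k. rvec (\<delta> k)) X"
proof -
  obtain b where b: "summable b" "\<And>n. 0 \<le> b n" "\<And>n x. norm ((B ^^ n) x) \<le> b n * norm x"
    by (rule power_bound) blast
  obtain C where C: "0 \<le> C" "\<And>d. d \<in> D \<Longrightarrow> norm (rvec d) \<le> C" by (rule digits_bound) blast
  \<comment> \<open>These are the terms of the expansion whose digits start at index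
    \<open>k\<close>; its sum is the orbit point \<open>X k\<close>.\<close>
  define t where "t k j = (B ^^ Suc j) (rvec (\<delta> (k + j)))" for k j
  have t: "norm (t k j) \<le> b (Suc j) * C" for k j
    unfolding t_def using b(2,3) C assms by (meson mult_left_mono order_trans)
  have bC: "summable (\<lambda>j. b (Suc j) * C)"
    using b(1) by (intro summable_mult2) (simp add: summable_Suc_iff)
  have st: "summable (t k)" for k
    by (rule summable_comparison_test[OF _ bC]) (use t in auto)
  define X where "X k = suminf (t k)" for k
  have "X k = B (X (Suc k) + rvec (\<delta> k))" for k
  proof -
    have "X k = t k 0 + (\<Sum>j. t k (Suc j))"
      unfolding X_def using suminf_split_head[OF st[of k]] by simp
    also have "(\<Sum>j. t k (Suc j)) = (\<Sum>j. B (t (Suc k) j))" by (simp add: t_def)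
    also have "\<dots> = B (X (Suc k))"
      unfolding X_def
      by (rule bounded_linear.suminf[symmetric, OF _ st]) (rule matrix_vector_mul_bounded_linear)
    finally show ?thesis by (simp add: t_def matrix_vector_right_distrib)
  qed
  moreover have "norm (X k) \<le> (\<Sum>j. b (Suc j) * C)" for k
    unfolding X_def by (rule norm_suminf_le[OF _ bC]) (rule t)
  then have "bounded (range X)" by (auto simp: bounded_iff)
  ultimately show ?thesis unfolding orbit_def by blast
qed

text \<open>By \<open>orbit_sums\<close> these are the points with an expansion in negative powers
  of \<open>M\<close>, the digit \<open>\<delta> k\<close> having exponent
  \<open>-(k + 1)\<close>.\<close>

definition orbit_tile :: "(real ^ 'n) set" where
  "orbit_tile = {X 0 | X \<delta>. (\<forall>k. \<delta> k \<in> D) \<and> orbit (\<lambda>k. rvec (\<delta> k)) X}"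

lemma orbit_start_in_tile:
  "(\<And>k. \<delta> k \<in> D) \<Longrightarrow> orbit (\<lambda>k. rvec (\<delta> k)) X \<Longrightarrow> X 0 \<in> orbit_tile"
  unfolding orbit_tile_def by (intro CollectI exI[of _ X] exI[of _ \<delta>] conjI allI refl)

lemma orbit_tileE:
  assumes "x \<in> orbit_tile"
  obtains d x' where "d \<in> D" "x' \<in> orbit_tile" "x = B (x' + rvec d)"
proof -
  obtain X \<delta> where X: "x = X 0" "\<And>k. \<delta> k \<in> D" "orbit (\<lambda>k. rvec (\<delta> k)) X"
    using assms by (auto simp: orbit_tile_def)
  have "X (Suc 0) \<in> orbit_tile"
    using orbit_start_in_tile[OF _ orbit_shift[OF X(3)]] X(2) by simp
  moreover have "x = B (X (Suc 0) + rvec (\<delta> 0))"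
    unfolding X(1) by (rule orbit_step[OF X(3)])
  ultimately show thesis using that X(2) by blast
qed

lemma orbit_tileI:
  assumes "d \<in> D" "x \<in> orbit_tile"
  shows "B (x + rvec d) \<in> orbit_tile"
proof -
  obtain X \<delta> where X: "x = X 0" "\<And>k. \<delta> k \<in> D" "orbit (\<lambda>k. rvec (\<delta> k)) X"
    using assms by (auto simp: orbit_tile_def)
  \<comment> \<open>Prepend the new point and the new digit, shifting the old sequences by
    one.\<close>
  let ?X = "case_nat (B (x + rvec d)) X" and ?\<delta> = "case_nat d \<delta>"
  have "range ?X = insert (B (x + rvec d)) (range X)"
    by (auto simp: image_iff split: nat.splits)
  then have "bounded (range ?X)" using orbit_bounded[OF X(3)] by simp
  moreover have "?X k = B (?X (Suc k) + rvec (?\<delta> k))" for k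
  proof (cases k)
    case (Suc j)
    then show ?thesis using orbit_step[OF X(3), of j] by simp
  qed (simp add: X(1))
  ultimately have "orbit (\<lambda>k. rvec (?\<delta> k)) ?X" unfolding orbit_def by blast
  moreover have "?\<delta> k \<in> D" for k using assms(1) X(2) by (auto split: nat.split)
  ultimately show ?thesis using orbit_start_in_tile[of ?\<delta> ?X] by simp
qed

section \<open>Identification of the tile with the set of expansions\<close>

lemma orbit_tile_fixed: "orbit_tile = (\<Union>d\<in>D. (\<lambda>x. B (x + rvec d)) ` orbit_tile)"
proof
  show "orbit_tile \<subseteq> (\<Union>d\<in>D. (\<lambda>x. B (x + rvec d)) ` orbit_tile)"
    by (rule subsetI) (erule orbit_tileE, blast)
qed (use orbit_tileI in blast)

lemma orbit_tile_nonempty: "orbit_tile \<noteq> {}"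
proof -
  obtain d where "d \<in> D" using digits unfolding complete_residue_system_def by blast
  then obtain X where "orbit (\<lambda>_. rvec d) X"
    using orbit_exists[of "\<lambda>_. d"] by blast
  from orbit_start_in_tile[of "\<lambda>_. d" X, OF \<open>d \<in> D\<close> this] show ?thesis by blast
qed

lemma bounded_orbit_tile: "bounded orbit_tile"
proof -
  obtain b where b: "summable b" "\<And>n. 0 \<le> b n" "\<And>n x. norm ((B ^^ n) x) \<le> b n * norm x"
    by (rule power_bound) blast
  obtain C where C: "0 \<le> C" "\<And>d. d \<in> D \<Longrightarrow> norm (rvec d) \<le> C" by (rule digits_bound) blast
  have bC: "summable (\<lambda>j. b (Suc j) * C)"
    using b(1) by (intro summable_mult2) (simp add: summable_Suc_iff)
  have "norm x \<le> (\<Sum>j. b (Suc j) * C)" if "x \<in> orbit_tile" for x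
  proof -
    obtain X \<delta> where X: "x = X 0" "\<And>k. \<delta> k \<in> D" "orbit (\<lambda>k. rvec (\<delta> k)) X"
      using \<open>x \<in> orbit_tile\<close> by (auto simp: orbit_tile_def)
    have "x = (\<Sum>k. (B ^^ Suc k) (rvec (\<delta> k)))"
      using orbit_sums[OF X(3)] X(1) by (simp add: sums_unique)
    also have "norm \<dots> \<le> (\<Sum>j. b (Suc j) * C)"
    proof (rule norm_suminf_le[OF _ bC])
      show "norm ((B ^^ Suc k) (rvec (\<delta> k))) \<le> b (Suc k) * C" for k
        using b(2,3) C X(2) by (meson mult_left_mono order_trans)
    qed
    finally show ?thesis .
  qed
  then show ?thesis by (auto simp: bounded_iff)
qed

text \<open>The closure is taken only to have a compact fixed point at hand; uniqueness then shows that
  \<open>orbit_tile\<close> is already closed.\<close>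

lemma closure_orbit_tile_fixed:
  "closure orbit_tile = (\<Union>d\<in>D. (\<lambda>x. B (x + rvec d)) ` closure orbit_tile)"
proof -
  \<comment> \<open>Closure commutes with injective affine maps, and below with the finite union
    over digits.\<close>
  have "(\<lambda>x. B (x + rvec d)) ` closure S = closure ((\<lambda>x. B (x + rvec d)) ` S)" for d and S :: "(real ^ 'n) set"
  proof -
    have im: "(\<lambda>x. B (x + rvec d)) ` S = B ` ((+) (rvec d) ` S)" for S
      by (simp add: image_image add.commute)
    have "inj B" by (metis A_B injI)
    show ?thesis
      unfolding im closure_translation[symmetric]
      by (rule closure_injective_linear_image[OF linear_B \<open>inj B\<close>])
  qed
  then show ?thesis
    by (subst (1) orbit_tile_fixed) (simp add: closure_finite_UN[OF finite_digits])
qed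

text \<open>From a point of \<open>T\<close> digits can be peeled off forever inside the bounded set
  \<open>T\<close>, which gives an orbit. Conversely, applying the first digit maps of an orbit to
  any point of \<open>T\<close> gives points of \<open>T\<close> that converge to the start of the
  orbit, and \<open>T\<close> is closed.\<close>

lemma fixed_eq_orbit_tile:
  assumes "T \<noteq> {}" "compact T" and fixed: "T = (\<Union>d\<in>D. (\<lambda>x. B (x + rvec d)) ` T)"
  shows "T = orbit_tile"
proof
  have preimage: "\<exists>d\<in>D. \<exists>z\<in>T. y = B (z + rvec d)" if "y \<in> T" for y
    using that by (subst (asm) fixed) blast
  show "T \<subseteq> orbit_tile"
  proof
    fix x assume x: "x \<in> T"
    \<comment> \<open>Dependent choice; the clause for \<open>k = 0\<close> fixes the start at
      \<open>x\<close>.\<close>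
    have "\<exists>X. \<forall>k. (X k \<in> T \<and> (k = 0 \<longrightarrow> X k = x)) \<and> (\<exists>d\<in>D. X k = B (X (Suc k) + rvec d))"
    proof (rule dependent_nat_choice[where P = "\<lambda>k z. z \<in> T \<and> (k = 0 \<longrightarrow> z = x)"
          and Q = "\<lambda>_ y z. \<exists>d\<in>D. y = B (z + rvec d)"])
      show "\<exists>y. y \<in> T \<and> (0 = (0::nat) \<longrightarrow> y = x)" using x by blast
      fix y and k :: nat assume "y \<in> T \<and> (k = 0 \<longrightarrow> y = x)"
      then show "\<exists>z. (z \<in> T \<and> (Suc k = 0 \<longrightarrow> z = x)) \<and> (\<exists>d\<in>D. y = B (z + rvec d))"
        using preimage by (metis nat.distinct(1))
    qed
    then obtain X where "\<forall>k. (X k \<in> T \<and> (k = 0 \<longrightarrow> X k = x)) \<and> (\<exists>d\<in>D. X k = B (X (Suc k) + rvec d))" ..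
    then have X: "X k \<in> T" "X 0 = x" "\<exists>d. d \<in> D \<and> X k = B (X (Suc k) + rvec d)" for k
      by blast+
    have "\<forall>k. \<exists>d. d \<in> D \<and> X k = B (X (Suc k) + rvec d)" by (intro allI X(3))
    from choice[OF this] obtain \<delta>
      where \<delta>': "\<forall>k. \<delta> k \<in> D \<and> X k = B (X (Suc k) + rvec (\<delta> k))" ..
    have \<delta>: "\<delta> k \<in> D" "X k = B (X (Suc k) + rvec (\<delta> k))" for k
      by (rule spec[OF \<delta>', THEN conjunct1], rule spec[OF \<delta>', THEN conjunct2])
    have "range X \<subseteq> T" using X(1) by (rule image_subsetI)
    then have "bounded (range X)" by (rule bounded_subset[OF compact_imp_bounded[OF assms(2)]])
    then have "orbit (\<lambda>k. rvec (\<delta> k)) X"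
      unfolding orbit_def by (intro conjI allI \<delta>(2))
    from orbit_start_in_tile[of \<delta> X, OF \<delta>(1) this] show "x \<in> orbit_tile" unfolding X(2) .
  qed
next
  obtain y where y: "y \<in> T" using assms(1) by blast
  have closed: "B (x + rvec d) \<in> T" if "x \<in> T" "d \<in> D" for x d
    by (subst fixed) (use that in blast)
  \<comment> \<open>This is the image of \<open>y\<close> under the first \<open>n\<close> digit
    maps: their composition has linear part \<open>B ^^ n\<close> and sends \<open>X n\<close> to
    \<open>X 0\<close>.\<close>
  have approx: "X 0 + (B ^^ n) (y - X n) \<in> T"
    if "\<And>k. \<delta> k \<in> D" "orbit (\<lambda>k. rvec (\<delta> k)) X" for X \<delta> n
    using that
  proof (induction n arbitrary: X \<delta>)
    case (Suc n)
    have "X (Suc 0) + (B ^^ n) (y - X (Suc n)) \<in> T"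
      using Suc.IH[OF _ orbit_shift[OF Suc.prems(2)]] Suc.prems(1) by simp
    from closed[OF this Suc.prems(1)[of 0]]
    have "B (X (Suc 0) + rvec (\<delta> 0)) + (B ^^ Suc n) (y - X (Suc n)) \<in> T"
      by (simp add: matrix_vector_right_distrib add_ac)
    moreover have "X 0 = B (X (Suc 0) + rvec (\<delta> 0))" using Suc.prems(2) by (rule orbit_step)
    ultimately show ?case by (simp only:)
  qed (use y in simp)
  show "orbit_tile \<subseteq> T"
  proof
    fix x assume "x \<in> orbit_tile"
    then obtain X \<delta> where X: "x = X 0" "\<And>k. \<delta> k \<in> D" "orbit (\<lambda>k. rvec (\<delta> k)) X"
      by (auto simp: orbit_tile_def)
    have "bounded (range (\<lambda>n. y - X n))"
      using orbit_bounded[OF X(3)] by (intro bounded_minus_comp) auto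
    then have "(\<lambda>n. X 0 + (B ^^ n) (y - X n)) \<longlonglongrightarrow> X 0 + 0"
      by (intro tendsto_add tendsto_const funpow_B_tendsto_0)
    from closed_sequentially[OF compact_imp_closed[OF assms(2)] approx[of \<delta> X, OF X(2,3)] this]
    show "x \<in> T" unfolding X(1) by simp
  qed
qed

lemma self_affine_tile_eq: "self_affine_tile M D = orbit_tile"
proof -
  have cl: "closure orbit_tile = orbit_tile"
    by (rule fixed_eq_orbit_tile[OF _ _ closure_orbit_tile_fixed])
       (use orbit_tile_nonempty bounded_orbit_tile in \<open>auto simp: compact_closure\<close>)
  have "compact orbit_tile"
    using cl bounded_orbit_tile by (metis compact_closure)
  then show ?thesis
    unfolding self_affine_tile_def
    using orbit_tile_nonempty orbit_tile_fixed fixed_eq_orbit_tile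
    by (intro the_equality) blast+
qed

section \<open>Differences of tile points and live sets\<close>

definition tile_differences :: "(int ^ 'n) set" where
  "tile_differences = {m. \<exists>x\<in>orbit_tile. \<exists>y\<in>orbit_tile. rvec m = x - y}"

lemma neighbor_set_eq: "neighbor_set M D = tile_differences - {0}"
proof -
  have "x = y + rvec m \<longleftrightarrow> rvec m = x - y" for x y m
    by (rule iffI) simp_all
  then have "orbit_tile \<inter> (\<lambda>x. x + rvec m) ` orbit_tile \<noteq> {} \<longleftrightarrow> m \<in> tile_differences" for m
    unfolding tile_differences_def by blast
  then show ?thesis
    unfolding neighbor_set_def self_affine_tile_eq by blast
qed

lemma finite_tile_differences: "finite tile_differences"
proof -
  obtain C where C: "\<And>x. x \<in> orbit_tile \<Longrightarrow> norm x \<le> C"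
    using bounded_orbit_tile by (auto simp: bounded_iff)
  have "tile_differences \<subseteq> {z. norm (rvec z) \<le> 2 * C}"
  proof
    fix m assume "m \<in> tile_differences"
    then obtain x y where xy: "x \<in> orbit_tile" "y \<in> orbit_tile" "rvec m = x - y"
      by (auto simp: tile_differences_def)
    have "norm (x - y) \<le> 2 * C"
      using norm_triangle_ineq4[of x y] C[OF xy(1)] C[OF xy(2)] by linarith
    then show "m \<in> {z. norm (rvec z) \<le> 2 * C}" using xy(3) by simp
  qed
  then show ?thesis by (rule finite_subset[OF _ finite_int_vec_bounded])
qed

text \<open>Removing the first digits of both points multiplies their difference by \<open>M\<close>
  and shifts it by a difference of digits, which is exactly a step.\<close>

lemma live_tile_differences: "live M D tile_differences"
  unfolding live_def
proof
  fix m assume "m \<in> tile_differences"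
  then obtain x y where xy: "x \<in> orbit_tile" "y \<in> orbit_tile" "rvec m = x - y"
    by (auto simp: tile_differences_def)
  obtain d x' where x': "d \<in> D" "x' \<in> orbit_tile" "x = B (x' + rvec d)"
    using xy(1) by (rule orbit_tileE)
  obtain d' y' where y': "d' \<in> D" "y' \<in> orbit_tile" "y = B (y' + rvec d')"
    using xy(2) by (rule orbit_tileE)
  have "rvec (M *v m + d' - d) = x' - y'"
    using xy(3) x'(3) y'(3)
    by (simp add: vec_of_int_add vec_of_int_diff vec_of_int_mult matrix_vector_mult_diff_distrib)
  then have "M *v m + d' - d \<in> tile_differences"
    using x'(2) y'(2) unfolding tile_differences_def by blast
  then show "\<exists>m'\<in>tile_differences. step M D m m'"
    using x'(1) y'(1) unfolding step_def by blast
qed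

text \<open>An infinite walk in the finite set \<open>C\<close> is bounded, so it is itself an orbit
  for the differences of its two digit sequences. So is the difference of the orbits of these
  sequences, and both start at the sum of the same series.\<close>

lemma live_subset_tile_differences:
  assumes "finite C" "live M D C"
  shows "C \<subseteq> tile_differences"
proof
  fix m assume m: "m \<in> C"
  have "\<exists>f. \<forall>k. (f k \<in> C \<and> (k = 0 \<longrightarrow> f k = m)) \<and> step M D (f k) (f (Suc k))"
  proof (rule dependent_nat_choice[where P = "\<lambda>k z. z \<in> C \<and> (k = 0 \<longrightarrow> z = m)"
        and Q = "\<lambda>_. step M D"])
    show "\<exists>z. z \<in> C \<and> (0 = (0::nat) \<longrightarrow> z = m)" using m by blast
    fix z and k :: nat assume "z \<in> C \<and> (k = 0 \<longrightarrow> z = m)"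
    then show "\<exists>z'. (z' \<in> C \<and> (Suc k = 0 \<longrightarrow> z' = m)) \<and> step M D z z'"
      using assms(2) unfolding live_def by auto
  qed
  then obtain f where "\<forall>k. (f k \<in> C \<and> (k = 0 \<longrightarrow> f k = m)) \<and> step M D (f k) (f (Suc k))" ..
  then have f: "f k \<in> C" "f 0 = m" "step M D (f k) (f (Suc k))" for k
    by blast+
  from f(3) obtain \<delta> \<epsilon> where d: "\<And>k. \<delta> k \<in> D" "\<And>k. \<epsilon> k \<in> D"
      "\<And>k. f (Suc k) = M *v f k + \<epsilon> k - \<delta> k"
    unfolding step_def by metis
  obtain X where X: "orbit (\<lambda>k. rvec (\<delta> k)) X" using orbit_exists[of \<delta>, OF d(1)] by blast
  obtain Y where Y: "orbit (\<lambda>k. rvec (\<epsilon> k)) Y" using orbit_exists[of \<epsilon>, OF d(2)] by blast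
  have "orbit (\<lambda>k. rvec (\<delta> k) - rvec (\<epsilon> k)) (\<lambda>k. rvec (f k))"
    unfolding orbit_def
  proof (intro conjI allI)
    have "range (\<lambda>k. rvec (f k)) \<subseteq> rvec ` C" using f(1) by auto
    then show "bounded (range (\<lambda>k. rvec (f k)))"
      by (meson assms(1) bounded_subset finite_imageI finite_imp_bounded)
    show "rvec (f k) = B (rvec (f (Suc k)) + (rvec (\<delta> k) - rvec (\<epsilon> k)))" for k
      by (simp add: d(3) vec_of_int_add vec_of_int_diff vec_of_int_mult)
  qed
  from sums_unique2[OF orbit_sums[OF this] orbit_sums[OF orbit_diff[OF X Y]]]
  have "rvec m = X 0 - Y 0" using f(2) by simp
  moreover have "X 0 \<in> orbit_tile" "Y 0 \<in> orbit_tile"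
    using orbit_start_in_tile[of \<delta>, OF d(1) X] orbit_start_in_tile[of \<epsilon>, OF d(2) Y] .
  ultimately show "m \<in> tile_differences" unfolding tile_differences_def by blast
qed

text \<open>With \<open>t\<^sub>j\<close> the tail sums of the norm bounds of \<open>M\<^sup>-\<^sup>j\<close>, the estimate
  \<open>\<bar>M\<^sup>-\<^sup>j y\<bar> \<le> \<rho> t\<^sub>j + 2 C t\<^sub>j\<^sub>+\<^sub>1\<close> is inherited along backward steps.\<close>

lemma finite_contact_seq: "finite (\<Union>k. contact_seq M D e k)"
proof -
  obtain b where b: "summable b" "\<And>n. 0 \<le> b n" "\<And>n x. norm ((B ^^ n) x) \<le> b n * norm x"
    by (rule power_bound) blast
  obtain C where C: "0 \<le> C" "\<And>d. d \<in> D \<Longrightarrow> norm (rvec d) \<le> C" by (rule digits_bound) blast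
  define t where "t j = (\<Sum>i. b (i + j))" for j
  have t_Suc: "t j = b j + t (Suc j)" for j
    unfolding t_def using suminf_split_head[of "\<lambda>i. b (i + j)"] summable_ignore_initial_segment[OF b(1)]
    by simp
  have t_nonneg: "0 \<le> t j" for j
    unfolding t_def by (intro suminf_nonneg summable_ignore_initial_segment b)
  define \<rho> where "\<rho> = (\<Sum>y\<in>contact_seq M D e 0. norm (rvec y))"
  have \<rho>: "norm (rvec y) \<le> \<rho>" if "y \<in> contact_seq M D e 0" for y
    unfolding \<rho>_def by (rule member_le_sum[OF that]) auto
  have "0 \<le> \<rho>" unfolding \<rho>_def by (rule sum_nonneg) simp
  have "norm ((B ^^ j) (rvec y)) \<le> \<rho> * t j + 2 * C * t (Suc j)" if "y \<in> contact_seq M D e k" for y j k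
    using that
  proof (induction k arbitrary: y j)
    case 0
    have "norm ((B ^^ j) (rvec y)) \<le> b j * \<rho>"
      using b(2,3) \<rho>[OF 0] by (meson mult_left_mono order_trans)
    also have "\<dots> \<le> \<rho> * t j"
      using t_Suc[of j] t_nonneg[of "Suc j"] \<open>0 \<le> \<rho>\<close> by (simp add: mult.commute mult_left_mono)
    finally show ?case using C(1) t_nonneg[of "Suc j"] by (simp add: add_increasing2)
  next
    case (Suc k)
    show ?case
    proof (cases "y \<in> contact_seq M D e k")
      case False
      then obtain y' where y': "y' \<in> contact_seq M D e k" "step M D y y'"
        using Suc.prems unfolding contact_seq_Suc by blast
      then obtain d d' where d: "d \<in> D" "d' \<in> D" "y' = M *v y + d' - d"
        unfolding step_def by blast
      have "rvec y = B (rvec y' + (rvec d - rvec d'))"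
        by (simp add: d(3) vec_of_int_add vec_of_int_diff vec_of_int_mult)
      then have "(B ^^ j) (rvec y) = (B ^^ Suc j) (rvec y') + (B ^^ Suc j) (rvec d - rvec d')"
        by (simp only: funpow_B_B funpow_B_add)
      then have "norm ((B ^^ j) (rvec y))
          \<le> norm ((B ^^ Suc j) (rvec y')) + norm ((B ^^ Suc j) (rvec d - rvec d'))"
        by (metis norm_triangle_ineq)
      also have "norm ((B ^^ Suc j) (rvec y')) \<le> \<rho> * t (Suc j) + 2 * C * t (Suc (Suc j))"
        by (rule Suc.IH[OF y'(1)])
      also have "norm ((B ^^ Suc j) (rvec d - rvec d')) \<le> b (Suc j) * (2 * C)"
      proof -
        have "norm (rvec d - rvec d') \<le> 2 * C"
          using C(2)[OF d(1)] C(2)[OF d(2)] by norm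
        then show ?thesis using b(2,3) by (meson mult_left_mono order_trans)
      qed
      \<comment> \<open>The digit term is absorbed into the tail sum:
        \<open>b (Suc j) + t (Suc (Suc j)) = t (Suc j)\<close>.\<close>
      also have "\<rho> * t (Suc j) + 2 * C * t (Suc (Suc j)) + b (Suc j) * (2 * C)
          = \<rho> * t (Suc j) + 2 * C * t (Suc j)"
        using t_Suc[of "Suc j"] by (simp add: algebra_simps)
      also have "\<dots> \<le> \<rho> * t j + 2 * C * t (Suc j)"
        using t_Suc[of j] b(2)[of j] \<open>0 \<le> \<rho>\<close> by (simp add: mult_left_mono)
      finally show ?thesis by simp
    qed (rule Suc.IH)
  qed
  \<comment> \<open>For \<open>j = 0\<close> the estimate bounds \<open>y\<close> itself, uniformly
    in the stage \<open>k\<close>.\<close>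
  from this[where j = 0] have "(\<Union>k. contact_seq M D e k) \<subseteq> {z. norm (rvec z) \<le> \<rho> * t 0 + 2 * C * t (Suc 0)}"
    by fastforce
  then show ?thesis by (rule finite_subset[OF _ finite_int_vec_bounded])
qed

section \<open>Termination and output of the algorithm\<close>

lemma zero_in_contact_set: "0 \<in> contact_set M D e"
proof -
  obtain d where "d \<in> D" using digits unfolding complete_residue_system_def by blast
  \<comment> \<open>Every digit \<open>d\<close> labels a loop \<open>d|d\<close> at 0.\<close>
  then have "live M D {0}" by (auto simp: live_def step_def intro: bexI[of _ d])
  moreover have "0 \<in> contact_seq M D e 0" by simp
  then have "{0} \<subseteq> (\<Union>k. contact_seq M D e k)" by blast
  ultimately have "{0} \<subseteq> contact_set M D e"
    unfolding contact_set_def Union_contact_seq by (intro reduced_nodes_greatest)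
  then show ?thesis by simp
qed

lemma algorithm_correct:
  assumes "lattice_basis e"
  shows "\<exists>q. stops_at M D (contact_set M D e) q \<and>
    algorithm_nodes M D (contact_set M D e) q = tile_differences"
proof -
  let ?R = "contact_set M D e"
  define Q where "Q = algorithm_nodes M D ?R"
  have Q1: "Q (Suc 0) = ?R" by (simp add: Q_def algorithm_nodes_def)
  have Q_Suc: "Q (Suc q) = reduced_nodes M D (Q q + ?R)" if "1 \<le> q" for q
    using that by (cases q) (simp_all add: Q_def algorithm_nodes_def)
  have R: "finite ?R" "live M D ?R"
    unfolding contact_set_def Union_contact_seq
    by (rule finite_subset[OF reduced_nodes_subset finite_contact_seq]) (rule live_reduced_nodes)
  have fin: "finite (Q q) \<and> live M D (Q q)" if "1 \<le> q" for q
    using that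
  proof (induction q rule: nat_induct_at_least)
    case base
    show ?case using R Q1 by simp
  next
    case (Suc q)
    then have "finite (Q q + ?R)" using R(1) by (simp add: finite_set_plus)
    then show ?case
      using Suc.hyps Q_Suc reduced_nodes_subset live_reduced_nodes by (metis finite_subset)
  qed
  have sub: "Q q \<subseteq> tile_differences" if "1 \<le> q" for q
    using fin[OF that] live_subset_tile_differences by blast
  have mono: "Q q \<subseteq> Q (Suc q)" if "1 \<le> q" for q
    unfolding Q_Suc[OF that]
  proof (rule reduced_nodes_greatest)
    \<comment> \<open>Adding 0, an element of \<open>?R\<close>, keeps \<open>Q q\<close> inside the
      Minkowski sum.\<close>
    show "Q q \<subseteq> Q q + ?R" using set_zero_plus2[OF zero_in_contact_set] by (simp add: add.commute)
  qed (use fin[OF that] in blast)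
  have R_sub: "?R \<subseteq> Q q" if "1 \<le> q" for q
    using that
  proof (induction q rule: nat_induct_at_least)
    case (Suc q)
    then show ?case using mono by blast
  qed (simp add: Q1)
  have "\<exists>q. 2 \<le> q \<and> Q q = Q (q - 1)"
  proof (rule ccontr)
    assume "\<nexists>q. 2 \<le> q \<and> Q q = Q (q - 1)"
    \<comment> \<open>The sequence starts at index 1, so the first comparison is between indices 2
      and 1.\<close>
    then have "\<not> (2 \<le> Suc (Suc q) \<and> Q (Suc (Suc q)) = Q (Suc (Suc q) - 1))" for q by blast
    then have ne: "Q (Suc (Suc q)) \<noteq> Q (Suc q)" for q by simp
    \<comment> \<open>Without a repetition the sets grow strictly, although their cardinalities are
      bounded by that of the finite set \<open>tile_differences\<close>.\<close>
    have "Q (Suc q) \<subset> Q (Suc (Suc q))" for q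
      using mono[of "Suc q"] ne[of q] by auto
    then have "card (Q (Suc q)) < card (Q (Suc (Suc q)))" for q
      using fin[of "Suc (Suc q)"] by (intro psubset_card_mono) auto
    then have "strict_mono (\<lambda>q. card (Q (Suc q)))" by (simp add: strict_mono_Suc_iff)
    then have "q \<le> card (Q (Suc q))" for q by (rule strict_mono_imp_increasing)
    moreover have "card (Q (Suc q)) \<le> card tile_differences" for q
      by (intro card_mono finite_tile_differences sub) simp
    ultimately show False by (metis Suc_n_not_le_n order_trans)
  qed
  then obtain q where q: "2 \<le> q" "Q q = Q (q - 1)"
    and first: "\<And>p. p < q \<Longrightarrow> \<not> (2 \<le> p \<and> Q p = Q (p - 1))"
    using exists_least_iff[of "\<lambda>q. 2 \<le> q \<and> Q q = Q (q - 1)"] by blast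
  have stops: "stops_at M D ?R q"
    unfolding stops_at_def using q first by (auto simp: Q_def)
  \<comment> \<open>Since \<open>Q (q - 1) = Q q\<close>, the round producing \<open>Q q\<close> can
    be read as starting from \<open>Q q\<close>, so \<open>Q q\<close> is a fixed point.\<close>
  have "Q q = reduced_nodes M D (Q q + ?R)"
    using Q_Suc[of "q - 1"] q by simp
  then have "tile_differences \<subseteq> Q q"
    using absorbed_fixed_point[OF digits assms finite_contact_seq, of "Q q"] fin[of q] R_sub[of q] q(1)
    by (intro live_subset_of_absorbed[OF finite_tile_differences live_tile_differences]) auto
  then have "Q q = tile_differences" using sub[of q] q(1) by auto
  with stops show ?thesis unfolding Q_def by blast
qed

end

theorem theorem1p5:
  fixes M :: "int ^ 'n ^ 'n" and D :: "(int ^ 'n) set" and e :: "'n \<Rightarrow> int ^ 'n"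
  assumes "expanding M"
    and "complete_residue_system M D"
    and "lattice_basis e"
  shows "\<exists>q. stops_at M D (contact_set M D e) q \<and>
           difference_graph M D (algorithm_nodes M D (contact_set M D e) q - {0}) =
             difference_graph M D (neighbor_set M D)"
proof -
  interpret expanding_digits M D by unfold_locales (rule assms)+
  show ?thesis using algorithm_correct[OF assms(3)] by (auto simp: neighbor_set_eq)
qed

end
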